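(* Let $n$ observers observe a target in $\mathbb{R}^3$. Fix an observer $i\in\{1,\dots,n\}$ and a time step $k$. For each observer $j$, let $\mathbf{g}_{j,k}\in\mathbb{R}^3$ (a unit vector) and $\mathbf{h}_{j,k}\in\mathbb{R}^3$ be its bearing vector and bearing rate with respect to the target at time $k$. Let $w_{ij,k}\in\{0,1\}$ indicate whether observer $i$ can obtain the information of observer $j$ at time $k$, with $w_{ii,k}=1$. Define the observability matrix $$\mathbf{Q}_{i,k}=\begin{bmatrix} w_{i1,k}\mathbf{H}_{\mathbf{g}_{1,k}}\mathbf{A}^k\\ w_{i1,k}\mathbf{H}_{\mathbf{h}_{1,k}}\mathbf{A}^k\\ \vdots\\ w_{in,k}\mathbf{H}_{\mathbf{g}_{n,k}}\mathbf{A}^k\\ w_{in,k}\mathbf{H}_{\mathbf{h}_{n,k}}\mathbf{A}^k\end{bmatrix}\in\mathbb{R}^{6n\times 6},$$ where $$\mathbf{H}_{\mathbf{g}_{j,k}}=\begin{bmatrix}\mathbf{P}_{\mathbf{g}_{j,k}} & \mathbf{0}\end{bmatrix}\in\mathbb{R}^{3\times 6},\qquad \mathbf{H}_{\mathbf{h}_{j,k}}=\begin{bmatrix}-\mathbf{h}_{j,k}\mathbf{g}_{j,k}^T & \mathbf{P}_{\mathbf{g}_{j,k}}\end{bmatrix}\in\mathbb{R}^{3\times 6},\qquad \mathbf{A}=\begin{bmatrix}\mathbf{I}&\Delta t\,\mathbf{I}\\ \mathbf{0}&\mathbf{I}\end{bmatrix}\in\mathbb{R}^{6\times 6},$$ and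 $\mathbf{P}_{\mathbf{g}}=\mathbf{I}-\mathbf{g}\mathbf{g}^T$. Then $\mathbf{Q}_{i,k}$ has full column rank (that is, rank $6$) if and only if there is at least one neighbor $j$ of observer $i$ at time $k$ whose bearing vector $\mathbf{g}_{j,k}$ is not parallel to $\mathbf{g}_{i,k}$.
   Context: At a given time step, observer $j$ has position $\mathbf{p}_j$ and velocity $\mathbf{v}_j$ in $\mathbb{R}^3$. The target has position $\mathbf{p}_{\rm T}$ and velocity $\mathbf{v}_{\rm T}$ in $\mathbb{R}^3$, with $\mathbf{p}_{\rm T}\neq\mathbf{p}_j$ for every $j$, so that bearings are defined. The bearing vector of observer $j$ is $\mathbf{g}_j=(\mathbf{p}_{\rm T}-\mathbf{p}_j)/r_j$ with $r_j=\|\mathbf{p}_{\rm T}-\mathbf{p}_j\|_2$; it is a unit vector. The bearing rate is its time derivative, $\mathbf{h}_j=\mathbf{P}_{\mathbf{g}_j}(\mathbf{v}_{\rm T}-\mathbf{v}_j)/r_j$, where $\mathbf{P}_{\mathbf{g}}=\mathbf{I}-\mathbf{g}\mathbf{g}^T$ is the $3\times 3$ orthogonal projection onto the plane orthogonal to the unit vector $\mathbf{g}$; in particular $\mathbf{h}_j^T\mathbf{g}_j=0$. The subscript $k$ denotes the value at discrete time step $k$. The sampling time is $\Delta t>0$, and $\mathbf{I}$, $\mathbf{0}$ are the $3\times 3$ identity and zero matrices. The target state is $\mathbf{x}_k=[\mathbf{p}_{{\rm T},k}^T,\mathbf{v}_{{\rm T},k}^T]^T\in\mathbb{R}^6$,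 and $\mathbf{A}$ is its (discrete-time double-integrator) state transition matrix. $\mathbf{H}_{\mathbf{g}_{j,k}}$ and $\mathbf{H}_{\mathbf{h}_{j,k}}$ are the matrices of the pseudo-linear measurement equations for the bearing and the bearing rate of observer $j$. An observer $j\ne i$ is a neighbor of observer $i$ at time $k$ if and only if $w_{ij,k}=1$. Two vectors are parallel if they are linearly dependent (for unit vectors, $\mathbf{g}_{j}=\pm\mathbf{g}_{i}$). *)

theory Defs
  imports "HOL-Analysis.Analysis"
begin

(* R^6 is real ^ (3 + 3): the sum type splits coordinates into two 3-blocks, so that
   block matrices are matrices indexed by sum types. *)

definition hblock :: "real ^ 'a ^ 'm \<Rightarrow> real ^ 'b ^ 'm \<Rightarrow> real ^ ('a + 'b) ^ 'm" where
  "hblock M N = (\<chi> r c. case c of Inl a \<Rightarrow> M $ r $ a | Inr b \<Rightarrow> N $ r $ b)"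

definition vblock :: "real ^ 'm ^ 'a \<Rightarrow> real ^ 'm ^ 'b \<Rightarrow> real ^ 'm ^ ('a + 'b)" where
  "vblock M N = (\<chi> r. case r of Inl a \<Rightarrow> M $ a | Inr b \<Rightarrow> N $ b)"

(* Power with respect to the matrix product; the library's ^ on vectors of vectors
   would be the componentwise power. *)
primrec matrix_power :: "real ^ 'm ^ 'm \<Rightarrow> nat \<Rightarrow> real ^ 'm ^ 'm" where
  "matrix_power M 0 = mat 1"
| "matrix_power M (Suc k) = M ** matrix_power M k"

(* u v^T *)
definition outer :: "real ^ 'a \<Rightarrow> real ^ 'b \<Rightarrow> real ^ 'b ^ 'a" where
  "outer u v = (\<chi> r c. u $ r * v $ c)"

definition proj :: "real ^ 3 \<Rightarrow> real ^ 3 ^ 3" where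
  "proj g = mat 1 - outer g g"

definition bearing :: "real ^ 3 \<Rightarrow> real ^ 3 \<Rightarrow> real ^ 3" where
  "bearing p pT = (pT - p) /\<^sub>R norm (pT - p)"

(* The time derivative of the bearing, where v and vT are the velocities
   of the observer and of the target. *)
definition bearing_rate :: "real ^ 3 \<Rightarrow> real ^ 3 \<Rightarrow> real ^ 3 \<Rightarrow> real ^ 3 \<Rightarrow> real ^ 3" where
  "bearing_rate p v pT vT = (proj (bearing p pT) *v (vT - v)) /\<^sub>R norm (pT - p)"

definition transition_matrix :: "real \<Rightarrow> real ^ (3 + 3) ^ (3 + 3)" where
  "transition_matrix dt = vblock (hblock (mat 1) (dt *\<^sub>R mat 1)) (hblock 0 (mat 1))"

definition bearing_matrix :: "real ^ 3 \<Rightarrow> real ^ (3 + 3) ^ 3" where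
  "bearing_matrix g = hblock (proj g) 0"

definition bearing_rate_matrix :: "real ^ 3 \<Rightarrow> real ^ 3 \<Rightarrow> real ^ (3 + 3) ^ 3" where
  "bearing_rate_matrix g h = hblock (- outer h g) (proj g)"

(* Row (j, b) is row b of the 6 x 6 block contributed by observer j. The arguments w, g, h
   are the weights, bearings and bearing rates at time step k, as seen by one fixed observer. *)
definition observability_matrix ::
  "real \<Rightarrow> nat \<Rightarrow> ('n \<Rightarrow> real) \<Rightarrow> ('n \<Rightarrow> real ^ 3) \<Rightarrow> ('n \<Rightarrow> real ^ 3)
     \<Rightarrow> real ^ (3 + 3) ^ ('n::finite \<times> (3 + 3))" where
  "observability_matrix dt k w g h =
     (\<chi> r. case r of (j, b) \<Rightarrow>
        vblock (w j *\<^sub>R (bearing_matrix (g j) ** matrix_power (transition_matrix dt) k))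
               (w j *\<^sub>R (bearing_rate_matrix (g j) (h j) ** matrix_power (transition_matrix dt) k)) $ b)"

(* Linear dependence of the pair u, v; for u = v the set-based notion of the library
   would wrongly consider the singleton {u}. *)
definition parallel :: "real ^ 3 \<Rightarrow> real ^ 3 \<Rightarrow> bool" where
  "parallel u v \<longleftrightarrow> (\<exists>a b. (a \<noteq> 0 \<or> b \<noteq> 0) \<and> a *\<^sub>R u + b *\<^sub>R v = 0)"

definition neighbor :: "('n \<Rightarrow> 'n \<Rightarrow> nat \<Rightarrow> real) \<Rightarrow> nat \<Rightarrow> 'n \<Rightarrow> 'n \<Rightarrow> bool" where
  "neighbor w k i j \<longleftrightarrow> j \<noteq> i \<and> w i j k = 1"

end

(* Writing A^k x = (a, b), the vector x lies in the kernel of the observability matrix iff, for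
   each j with weight 1, a is a multiple of g_j and b - (g_j . b) g_j = (g_j . a) h_j. Two
   non-parallel bearings force a = 0 and then b = 0; if all available bearings are multiples of
   g_i, then (0, g_i) satisfies every equation. *)
theory Submission
  imports Defs
begin

text \<open>On a state in \<open>real ^ (3 + 3)\<close> this is the position half, and
  \<open>lower_part\<close> is the velocity half.\<close>

definition upper_part :: "real ^ ('a::finite + 'b::finite) \<Rightarrow> real ^ 'a" where
  "upper_part y = (\<chi> i. y $ Inl i)"

definition lower_part :: "real ^ ('a::finite + 'b::finite) \<Rightarrow> real ^ 'b" where
  "lower_part y = (\<chi> i. y $ Inr i)"

lemma hblock_mult_vector:
  fixes M :: "real ^ 'a::finite ^ 'm" and N :: "real ^ 'b::finite ^ 'm"
  shows "hblock M N *v y = M *v upper_part y + N *v lower_part y"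
proof -
  have "(\<Sum>c\<in>UNIV. (case c of Inl a \<Rightarrow> M $ r $ a | Inr b \<Rightarrow> N $ r $ b) * y $ c)
      = (\<Sum>a\<in>UNIV. M $ r $ a * y $ Inl a) + (\<Sum>b\<in>UNIV. N $ r $ b * y $ Inr b)" for r
    by (subst UNIV_Plus_UNIV [symmetric], subst sum.Plus) simp_all
  then show ?thesis
    by (simp add: vec_eq_iff matrix_vector_mult_def hblock_def upper_part_def lower_part_def)
qed

lemma sum_vec_eq_0_iff: "y = 0 \<longleftrightarrow> upper_part y = 0 \<and> lower_part y = 0"
proof -
  have "(\<forall>c. y $ c = 0) \<longleftrightarrow> (\<forall>i. y $ Inl i = 0) \<and> (\<forall>i. y $ Inr i = 0)"
    by (metis sum.exhaust)
  then show ?thesis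
    by (simp add: upper_part_def lower_part_def vec_eq_iff)
qed

lemma upper_part_vblock: "upper_part (vblock M N *v x) = M *v x"
  by (simp add: upper_part_def vblock_def matrix_vector_mult_def vec_eq_iff)

lemma lower_part_vblock: "lower_part (vblock M N *v x) = N *v x"
  by (simp add: lower_part_def vblock_def matrix_vector_mult_def vec_eq_iff)

text \<open>The matrix is block upper triangular with identity diagonal blocks: the lower half of
  the product is the lower half of \<open>x\<close>, and once that vanishes the upper half is the
  upper half of \<open>x\<close>.\<close>

lemma transition_matrix_eq_0_iff: "transition_matrix dt *v x = 0 \<longleftrightarrow> x = 0"
  by (auto simp: sum_vec_eq_0_iff transition_matrix_def upper_part_vblock lower_part_vblock
      hblock_mult_vector scaleR_matrix_vector_assoc [symmetric])

lemma matrix_power_transition_matrix_eq_0_iff: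
  "matrix_power (transition_matrix dt) k *v x = 0 \<longleftrightarrow> x = 0"
  by (induction k)
    (simp_all add: matrix_vector_mul_assoc [symmetric] transition_matrix_eq_0_iff)

text \<open>Allows the kernel condition to be restated for an arbitrary vector in place of $A^k
  x$.\<close>

lemma surj_matrix_power_transition_matrix: "surj ((*v) (matrix_power (transition_matrix dt) k))"
proof -
  have "inj ((*v) (matrix_power (transition_matrix dt) k))"
    by (simp add: linear_injective_0 matrix_power_transition_matrix_eq_0_iff)
  then show ?thesis
    by (simp add: linear_injective_imp_surjective)
qed

lemma outer_mult_vector: "outer u v *v x = (v \<bullet> x) *\<^sub>R u"
  by (simp add: vec_eq_iff outer_def matrix_vector_mult_def inner_vec_def
      sum_distrib_left mult_ac)

lemma proj_mult_vector: "proj g *v x = x - (g \<bullet> x) *\<^sub>R g"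
  by (simp add: proj_def matrix_vector_mult_diff_rdistrib outer_mult_vector)

lemma uminus_outer_mult_vector: "(- outer u v) *v x = - ((v \<bullet> x) *\<^sub>R u)"
  using matrix_vector_mult_diff_rdistrib [of 0 "outer u v" x] by (simp add: outer_mult_vector)

text \<open>The rows are grouped by observer. The rate equation $-h_j g_j^T a + P_{g_j} b = 0$ is
  written with its first term moved to the right-hand side.\<close>

lemma observability_matrix_eq_0_iff:
  fixes x :: "real ^ (3 + 3)"
  defines "y k dt \<equiv> matrix_power (transition_matrix dt) k *v x"
  shows "observability_matrix dt k w g h *v x = 0 \<longleftrightarrow>
    (\<forall>j. w j = 0 \<or> proj (g j) *v upper_part (y k dt) = 0 \<and>
       proj (g j) *v lower_part (y k dt) = (g j \<bullet> upper_part (y k dt)) *\<^sub>R h j)"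
proof -
  let ?A = "matrix_power (transition_matrix dt) k"
  let ?B = "\<lambda>j. vblock (w j *\<^sub>R (bearing_matrix (g j) ** ?A))
                         (w j *\<^sub>R (bearing_rate_matrix (g j) (h j) ** ?A))"
  have "observability_matrix dt k w g h *v x = 0 \<longleftrightarrow> (\<forall>j. ?B j *v x = 0)"
    by (simp add: vec_eq_iff matrix_vector_mult_def observability_matrix_def)
  \<comment> \<open>The weight is a common scalar factor of both blocks, so a block annihilates
    \<open>x\<close> if the weight is 0 or if both measurement matrices annihilate $A^k x$, and only
    then.\<close>
  moreover have "?B j *v x = 0 \<longleftrightarrow> w j = 0 \<or> bearing_matrix (g j) *v y k dt = 0 \<and>
      bearing_rate_matrix (g j) (h j) *v y k dt = 0" for j
    by (auto simp: sum_vec_eq_0_iff [of "?B j *v x"] upper_part_vblock lower_part_vblock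
        scaleR_matrix_vector_assoc [symmetric] matrix_vector_mul_assoc [symmetric] y_def)
  ultimately show ?thesis
    by (simp add: bearing_matrix_def bearing_rate_matrix_def hblock_mult_vector
        uminus_outer_mult_vector)
qed

lemma rank_observability_matrix:
  "rank (observability_matrix dt k w g h) = 6 \<longleftrightarrow>
    (\<forall>a b. (\<forall>j. w j = 0 \<or> proj (g j) *v a = 0 \<and> proj (g j) *v b = (g j \<bullet> a) *\<^sub>R h j)
       \<longrightarrow> a = 0 \<and> b = 0)" (is "_ \<longleftrightarrow> (\<forall>a b. ?E a b \<longrightarrow> _)")
proof -
  let ?Q = "observability_matrix dt k w g h"
  let ?A = "matrix_power (transition_matrix dt) k"
  \<comment> \<open>The number 6 is the number of columns, the cardinality of
    \<open>3 + 3\<close>.\<close>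
  have "rank ?Q = 6 \<longleftrightarrow> inj ((*v) ?Q)"
    using full_rank_injective [of ?Q] by simp
  also have "\<dots> \<longleftrightarrow> (\<forall>x. ?Q *v x = 0 \<longrightarrow> x = 0)"
    by (simp add: linear_injective_0)
  also have "\<dots> \<longleftrightarrow> (\<forall>x. ?E (upper_part (?A *v x)) (lower_part (?A *v x)) \<longrightarrow> ?A *v x = 0)"
    by (simp only: observability_matrix_eq_0_iff matrix_power_transition_matrix_eq_0_iff)
  also have "\<dots> \<longleftrightarrow> (\<forall>y. ?E (upper_part y) (lower_part y) \<longrightarrow> y = 0)"
  proof (intro iffI allI)
    fix y
    assume *: "\<forall>x. ?E (upper_part (?A *v x)) (lower_part (?A *v x)) \<longrightarrow> ?A *v x = 0"
    obtain x where "y = ?A *v x"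
      using surj_matrix_power_transition_matrix by (rule surjE)
    with * show "?E (upper_part y) (lower_part y) \<longrightarrow> y = 0"
      by simp
  qed simp
  also have "\<dots> \<longleftrightarrow> (\<forall>a b. ?E a b \<longrightarrow> a = 0 \<and> b = 0)"
  proof (intro iffI allI impI)
    fix a b :: "real ^ 3"
    assume trivial_kernel: "\<forall>y. ?E (upper_part y) (lower_part y) \<longrightarrow> y = 0" and "?E a b"
    define y :: "real ^ (3 + 3)" where "y = (\<chi> c. case c of Inl i \<Rightarrow> a $ i | Inr i \<Rightarrow> b $ i)"
    have y: "upper_part y = a" "lower_part y = b"
      by (simp_all add: y_def upper_part_def lower_part_def)
    with trivial_kernel \<open>?E a b\<close> have "y = 0"
      by blast
    with y show "a = 0 \<and> b = 0"
      using sum_vec_eq_0_iff [of y] by simp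
  next
    fix y :: "real ^ (3 + 3)"
    assume "\<forall>a b. ?E a b \<longrightarrow> a = 0 \<and> b = 0" "?E (upper_part y) (lower_part y)"
    then show "y = 0"
      unfolding sum_vec_eq_0_iff [of y] by blast
  qed
  finally show ?thesis .
qed

text \<open>Each projection equation makes \<open>x\<close> a multiple of its vector. Equating the
  two multiples gives a linear relation, whose coefficients must vanish.\<close>

lemma proj_eq_0_imp_eq_0:
  assumes "\<not> parallel g g'" "proj g *v x = 0" "proj g' *v x = 0"
  shows "x = 0"
proof -
  have *: "x = (g \<bullet> x) *\<^sub>R g" "x = (g' \<bullet> x) *\<^sub>R g'"
    using assms(2,3) by (simp_all add: proj_mult_vector)
  then have "(g \<bullet> x) *\<^sub>R g + (- (g' \<bullet> x)) *\<^sub>R g' = 0"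
    by simp
  with assms(1) have "g \<bullet> x = 0"
    unfolding parallel_def by blast
  with * show ?thesis
    by simp
qed

lemma proj_parallel_eq_0:
  assumes "parallel g g'" "norm g = 1" "norm g' = 1"
  shows "proj g *v g' = 0"
proof -
  obtain a b where ab: "a \<noteq> 0 \<or> b \<noteq> 0" "a *\<^sub>R g + b *\<^sub>R g' = 0"
    using assms(1) unfolding parallel_def by blast
  \<comment> \<open>If \<open>b\<close> were 0, then \<open>a\<close> would be nonzero with
    \<open>a *\<^sub>R g = 0\<close>, contradicting \<open>norm g = 1\<close>.\<close>
  with assms have "b \<noteq> 0"
    by auto
  with ab(2) have "g' = (- a / b) *\<^sub>R g"
    by (simp add: vec_eq_iff field_simps add_eq_0_iff)
  moreover have "g \<bullet> g = 1"
    using assms(2) by (simp add: norm_eq_1)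
  ultimately show ?thesis
    by (simp add: proj_mult_vector)
qed

lemma norm_bearing: "pT \<noteq> p \<Longrightarrow> norm (bearing p pT) = 1"
  by (simp add: bearing_def)

theorem theorem1:
  fixes p v :: "'n::finite \<Rightarrow> nat \<Rightarrow> real ^ 3"
    and pT vT :: "nat \<Rightarrow> real ^ 3"
    and g h :: "'n \<Rightarrow> nat \<Rightarrow> real ^ 3"
    and w :: "'n \<Rightarrow> 'n \<Rightarrow> nat \<Rightarrow> real"
    and dt :: real and i :: 'n and k :: nat
  assumes "dt > 0"
    and "\<And>j. pT k \<noteq> p j k"
    and "\<And>j. g j k = bearing (p j k) (pT k)"
    and "\<And>j. h j k = bearing_rate (p j k) (v j k) (pT k) (vT k)"
    and "\<And>j. w i j k \<in> {0, 1}"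
    and "w i i k = 1"
  shows "rank (observability_matrix dt k (\<lambda>j. w i j k) (\<lambda>j. g j k) (\<lambda>j. h j k)) = 6
    \<longleftrightarrow> (\<exists>j. neighbor w k i j \<and> \<not> parallel (g j k) (g i k))"
proof -
  have unit: "norm (g j k) = 1" for j
    using assms(2,3) by (simp add: norm_bearing)
  show ?thesis
    unfolding rank_observability_matrix
  proof (intro iffI allI impI)
    assume trivial_kernel: "\<forall>a b. (\<forall>j. w i j k = 0 \<or> proj (g j k) *v a = 0 \<and>
        proj (g j k) *v b = (g j k \<bullet> a) *\<^sub>R h j k) \<longrightarrow> a = 0 \<and> b = 0"
    show "\<exists>j. neighbor w k i j \<and> \<not> parallel (g j k) (g i k)"
    proof (rule ccontr)
      assume no_neighbor: "\<not> ?thesis"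
      \<comment> \<open>Observer \<open>i\<close> is not its own neighbor but contributes a block to
        the matrix, so the case \<open>j = i\<close> is treated separately.\<close>
      have "parallel (g i k) (g i k)"
        unfolding parallel_def by (rule exI [of _ 1], rule exI [of _ "-1"]) simp
      then have "w i j k = 0 \<or> parallel (g j k) (g i k)" for j
        using no_neighbor assms(5) [of j] by (cases "j = i") (auto simp: neighbor_def)
      then have "w i j k = 0 \<or> proj (g j k) *v g i k = 0" for j
        using proj_parallel_eq_0 unit by blast
      \<comment> \<open>With \<open>a = 0\<close> the bearing equations are trivial and the bearing
        rates drop out. What remains is $P_{g_j} g_i = 0$: a velocity along the common line of sight
        is invisible to every available observer.\<close>
      then have "g i k = 0"
        using trivial_kernel [rule_format, of 0 "g i k"] by simp
      with unit [of i] show False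
        by simp
    qed
  next
    fix a b
    assume "\<exists>j. neighbor w k i j \<and> \<not> parallel (g j k) (g i k)"
      and kernel: "\<forall>j. w i j k = 0 \<or> proj (g j k) *v a = 0 \<and>
        proj (g j k) *v b = (g j k \<bullet> a) *\<^sub>R h j k"
    then obtain j where j: "w i j k = 1" "\<not> parallel (g j k) (g i k)"
      by (auto simp: neighbor_def)
    \<comment> \<open>The second bearing is that of \<open>i\<close> itself, whose equations are
      present because \<open>w i i k = 1\<close>.\<close>
    have "a = 0"
      using proj_eq_0_imp_eq_0 [OF j(2)] kernel j(1) assms(6) by (metis zero_neq_one)
    \<comment> \<open>Now that \<open>a = 0\<close>, the right-hand sides of the rate equations
      vanish, and \<open>b\<close> satisfies the same two projection equations as \<open>a\<close>
      did.\<close>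
    moreover from this have "b = 0"
      using proj_eq_0_imp_eq_0 [OF j(2)] kernel j(1) assms(6)
      by (metis inner_zero_right scaleR_zero_left zero_neq_one)
    ultimately show "a = 0 \<and> b = 0" ..
  qed
qed

end
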